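(* Let $G$ be a connected graph on at least $2$ vertices. Then for all integers $m \ge 1$, the corona product $G \circ K_m$ has no periodic vertices and, therefore, has no perfect state transfer (between any two distinct vertices).
   Context: Graphs are finite, simple and undirected; $A(X)$ denotes the adjacency matrix of a graph $X$, and $e_u$ the standard basis vector indexed by vertex $u$. $K_m$ is the complete graph on $m$ vertices. The corona $G\circ H$ of graphs $G,H$ has vertex set $V(G)\times(\{0\}\cup V(H))$ (where $0\notin V(H)$), and $(v,w)$ is adjacent to $(v',w')$ iff one of the following holds: $w=w'=0$ and $v,v'$ are adjacent in $G$; or $v=v'$ and $w,w'\in V(H)$ are adjacent in $H$; or $v=v'$ and exactly one of $w,w'$ equals $0$. Put $U(t)=e^{-\mathrm{i}tA(X)}$ for a graph $X$. There is perfect state transfer between distinct vertices $u,v$ of $X$ at time $\tau$ if $|e_v^T U(\tau)e_u|=1$. A vertex $u$ of $X$ is periodic if $|e_u^TU(\tau)e_u|=1$ for some $\tau>0$. *)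

theory Defs
  imports "HOL-Analysis.Analysis"
begin

text \<open>
  A finite simple graph is given by its adjacency relation; its vertex set is the whole (finite,
  nonempty) carrier type, so that its number of vertices is the cardinality of that type.
\<close>

definition simple_graph :: "('v::finite \<Rightarrow> 'v \<Rightarrow> bool) \<Rightarrow> bool" where
  "simple_graph X \<longleftrightarrow> symp X \<and> irreflp X"

definition connected_graph :: "('v::finite \<Rightarrow> 'v \<Rightarrow> bool) \<Rightarrow> bool" where
  "connected_graph X \<longleftrightarrow> (\<forall>u v. X\<^sup>*\<^sup>* u v)"

text \<open>
  On a vertex type \<open>'m\<close> this is \<open>K\<^sub>m\<close> for \<open>m = CARD('m)\<close>. Letting \<open>'m\<close> range
  over all finite types amounts to letting \<open>m\<close> range over all integers \<open>m \<ge> 1\<close>.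
\<close>

definition complete_graph :: "'m::finite \<Rightarrow> 'm \<Rightarrow> bool" where
  "complete_graph x y \<longleftrightarrow> x \<noteq> y"

text \<open>
  The vertex set \<open>V(G) \<times> ({0} \<union> V(H))\<close> is rendered as \<open>'v \<times> 'w option\<close>, with
  \<^const>\<open>None\<close> in the role of the extra element \<open>0 \<notin> V(H)\<close>.
\<close>

definition corona ::
    "('v::finite \<Rightarrow> 'v \<Rightarrow> bool) \<Rightarrow> ('w::finite \<Rightarrow> 'w \<Rightarrow> bool) \<Rightarrow>
      'v \<times> 'w option \<Rightarrow> 'v \<times> 'w option \<Rightarrow> bool" where
  "corona G H p q \<longleftrightarrow>
    (case (p, q) of ((v, w), (v', w')) \<Rightarrow>
      (w = None \<and> w' = None \<and> G v v') \<or>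
      (v = v' \<and> (\<exists>x y. w = Some x \<and> w' = Some y \<and> H x y)) \<or>
      (v = v' \<and> (w = None) \<noteq> (w' = None)))"

lemma simple_graph_corona:
  assumes "simple_graph G" "simple_graph H"
  shows "simple_graph (corona G H)"
  using assms unfolding simple_graph_def symp_def irreflp_def corona_def
  by (auto split: prod.splits)

lemma simple_graph_complete_graph: "simple_graph complete_graph"
  by (auto simp: simple_graph_def complete_graph_def symp_def irreflp_def)

definition adjacency_matrix :: "('v::finite \<Rightarrow> 'v \<Rightarrow> bool) \<Rightarrow> complex^'v^'v" where
  "adjacency_matrix X = (\<chi> u v. if X u v then 1 else 0)"

text \<open>
  The operators \<open>*\<close>, \<open>^\<close> on \<^typ>\<open>complex^'n^'n\<close> act componentwise, so matrix
  powers are iterated \<open>**\<close>.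
\<close>

definition matrix_power :: "complex^'n^'n \<Rightarrow> nat \<Rightarrow> complex^'n^'n" where
  "matrix_power A k = (((**) A) ^^ k) (mat 1)"

definition matrix_exp :: "complex^'n^'n \<Rightarrow> complex^'n^'n" where
  "matrix_exp A = (\<Sum>k. matrix_power A k /\<^sub>R fact k)"

lemma norm_matrix_power_entry_le:
  fixes A :: "complex^'n^'n"
  assumes "\<And>i j. norm (A $ i $ j) \<le> M"
  shows "norm (matrix_power A k $ i $ j) \<le> (real CARD('n) * M) ^ k"
proof (induction k arbitrary: i j)
  case 0
  show ?case by (simp add: matrix_power_def mat_def)
next
  case (Suc k)
  have M: "0 \<le> M"
    using assms norm_ge_zero order_trans by blast
  have "norm (matrix_power A (Suc k) $ i $ j)
      = norm (\<Sum>l\<in>UNIV. A $ i $ l * matrix_power A k $ l $ j)"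
    by (simp add: matrix_power_def matrix_matrix_mult_def)
  also have "\<dots> \<le> (\<Sum>l\<in>(UNIV::'n set). M * (real CARD('n) * M) ^ k)"
    using M by (intro sum_norm_le) (auto simp: norm_mult intro!: mult_mono assms Suc.IH)
  also have "\<dots> = (real CARD('n) * M) ^ Suc k"
    by simp
  finally show ?case .
qed

lemma matrix_exp_sums:
  fixes A :: "complex^'n^'n"
  shows "(\<lambda>k. matrix_power A k /\<^sub>R fact k) sums matrix_exp A"
proof -
  define M where "M = Max (range (\<lambda>(i, j). norm (A $ i $ j)))"
  have M: "norm (A $ i $ j) \<le> M" for i j
    unfolding M_def by (rule Max_ge) (auto intro!: image_eqI[of _ _ "(i, j)"])
  define f where "f k = matrix_power A k /\<^sub>R fact k" for k
  have "summable (\<lambda>k. f k $ i $ j)" for i j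
  proof (rule summable_comparison_test)
    show "\<exists>N. \<forall>k\<ge>N. norm (f k $ i $ j) \<le> (real CARD('n) * M) ^ k /\<^sub>R fact k"
      using norm_matrix_power_entry_le[of A M, OF M]
      by (auto simp: f_def field_simps intro!: divide_right_mono)
  qed (rule summable_exp_generic)
  then have "(\<lambda>n. \<Sum>k<n. f k) \<longlonglongrightarrow> (\<chi> i j. \<Sum>k. f k $ i $ j)"
    by (auto intro!: vec_tendstoI summable_LIMSEQ)
  then have "summable f"
    by (auto simp: summable_def sums_def)
  then show ?thesis
    unfolding f_def matrix_exp_def by (rule summable_sums)
qed

definition transition_matrix :: "('v::finite \<Rightarrow> 'v \<Rightarrow> bool) \<Rightarrow> real \<Rightarrow> complex^'v^'v" where
  "transition_matrix X t =
    matrix_exp (\<chi> u v. - (\<i> * complex_of_real t) * adjacency_matrix X $ u $ v)"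

text \<open>
  Below, \<open>(U(\<tau>) *v axis u 1) $ v\<close> is \<open>e\<^sub>v\<^sup>T U(\<tau>) e\<^sub>u\<close>.
  The inner product \<open>\<bullet>\<close> is not used for it, because on \<^typ>\<open>complex^'v\<close> it
  is the real one.
\<close>

definition perfect_state_transfer_at ::
    "('v::finite \<Rightarrow> 'v \<Rightarrow> bool) \<Rightarrow> 'v \<Rightarrow> 'v \<Rightarrow> real \<Rightarrow> bool" where
  "perfect_state_transfer_at X u v \<tau> \<longleftrightarrow>
    u \<noteq> v \<and> cmod ((transition_matrix X \<tau> *v axis u 1) $ v) = 1"

definition periodic_vertex :: "('v::finite \<Rightarrow> 'v \<Rightarrow> bool) \<Rightarrow> 'v \<Rightarrow> bool" where
  "periodic_vertex X u \<longleftrightarrow>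
    (\<exists>\<tau>>0. cmod ((transition_matrix X \<tau> *v axis u 1) $ u) = 1)"

end

theory Submission
  imports Defs "HOL-Number_Theory.Cong"
begin

text \<open>
  Write \<open>X = G \<circ> K\<^sub>m\<close>. An eigenvector \<open>x\<close> of \<open>G\<close> with eigenvalue
  \<open>\<lambda>\<close> lifts to two eigenvectors of \<open>X\<close>, with eigenvalues \<open>p + m - 1\<close>, where
  \<open>p\<close> is one of the two roots of \<open>p\<^sup>2 = a p + m\<close>, \<open>a = \<lambda> - m + 1\<close>: put
  \<open>x v\<close> on the vertex \<open>v\<close> of \<open>G\<close> and \<open>x v / p\<close> on its copy of \<open>K\<^sub>m\<close>
  (\<open>corona_lift_eigenvector\<close>).

  Suppose that the entry of \<open>U(t)\<close> at \<open>v, u\<close> has modulus 1 with \<open>t \<noteq> 0\<close>; the case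
  \<open>v = u\<close> is periodicity, the case \<open>v \<noteq> u\<close> perfect state transfer. As \<open>U(t)\<close> is
  unitary and symmetric, it sends \<open>e\<^sub>u\<close> to \<open>\<gamma> e\<^sub>v\<close> and \<open>e\<^sub>v\<close> to
  \<open>\<gamma> e\<^sub>u\<close>. Hence \<open>exp (- 2 i t \<mu>) = \<gamma>\<^sup>2\<close> for every eigenvalue \<open>\<mu>\<close> having an
  eigenvector that does not vanish at \<open>u\<close>, and all such \<open>\<mu>\<close> differ by integer multiples
  of \<open>d = \<pi> / t\<close> (\<open>eigenvalue_difference_of_unimodular_entry\<close>).

  Let \<open>u\<close> lie over the vertex \<open>b\<close> of \<open>G\<close>. Since \<open>b\<close> has a neighbour and no loop,
  \<open>G\<close> has eigenvectors not vanishing at \<open>b\<close> for a negative eigenvalue \<open>l\<close> and for a positive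
  eigenvalue \<open>k\<close> (\<open>eigenvectors_of_both_signs\<close>). Their four lifts do not vanish at \<open>u\<close>.
  So \<open>sqrt (a\<^sup>2 + 4 m)\<close>, the difference of the two roots, is an integer multiple of \<open>d\<close>
  for \<open>a = l - m + 1\<close> and for \<open>a' = k - m + 1\<close>, and so is \<open>a - a'\<close>. It follows that
  \<open>a\<close> is a rational multiple of \<open>d\<close>, that \<open>d\<^sup>2\<close> is rational, and that the positive
  root \<open>p\<close> belonging to \<open>l\<close> has a rational square
  (\<open>rational_square_of_commensurable_roots\<close>). But \<open>p\<^sup>2\<close> is an eigenvalue of the integer
  matrix \<open>(A(X) - (m - 1) I)\<^sup>2\<close>, hence an integer, and so \<open>p \<ge> 1\<close>. Then
  \<open>a = p - m / p \<ge> 1 - m\<close>, that is, \<open>l \<ge> 0\<close>, a contradiction.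
\<close>

section \<open>Negative eigenvalues of self-adjoint maps\<close>

text \<open>
  On an invariant subspace where a self-adjoint map is positive semidefinite, an isotropic vector
  lies in the kernel: otherwise a short step from \<open>x\<close> in the direction \<open>- f x\<close> would make the
  quadratic form negative.
\<close>

lemma psd_zero_imp_kernel:
  fixes f :: "'a::euclidean_space \<Rightarrow> 'a"
  assumes lin: "linear f"
    and sym: "\<And>x y. f x \<bullet> y = x \<bullet> f y"
    and S: "subspace S" "f ` S \<subseteq> S"
    and psd: "\<And>y. y \<in> S \<Longrightarrow> 0 \<le> y \<bullet> f y"
    and x: "x \<in> S" "x \<bullet> f x = 0"
  shows "f x = 0"
proof (rule ccontr)
  assume nz: "f x \<noteq> 0"
  define a where "a = f x \<bullet> f x"
  define b where "b = f x \<bullet> f (f x)"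
  have a: "a > 0" using nz by (simp add: a_def)
  have fx: "f x \<in> S" using S x by blast
  have b: "b \<ge> 0" using psd[OF fx] by (simp add: b_def)
  \<comment> \<open>Any step \<open>t > 0\<close> with \<open>t * b < 2 * a\<close> works; adding 1 avoids a zero denominator.\<close>
  define t where "t = a / (b + 1)"
  have t: "t > 0" using a b by (simp add: t_def)
  have "x - t *\<^sub>R f x \<in> S"
    using S(1) x(1) fx by (simp add: subspace_diff subspace_scale)
  from psd[OF this] have "0 \<le> (x - t *\<^sub>R f x) \<bullet> f (x - t *\<^sub>R f x)" .
  also have "\<dots> = t * (t * b - 2 * a)"
    using x(2) sym[of x "f x"]
    by (simp add: linear_diff[OF lin] linear_scale[OF lin] inner_diff_left inner_diff_right
        a_def b_def algebra_simps)
  finally have "t * b \<ge> 2 * a"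
    using t by (simp add: zero_le_mult_iff)
  moreover have "t * b \<le> a"
    using a b by (simp add: t_def field_simps)
  ultimately show False using a by linarith
qed

text \<open>
  The eigenvector minimises the Rayleigh quotient on the smallest invariant subspace \<open>S\<close>
  containing \<open>e\<close>. The minimum is negative by the previous lemma. If the
  eigenvector were orthogonal to \<open>e\<close>, its orthogonal complement would be an invariant subspace
  containing \<open>e\<close>, hence would contain \<open>S\<close> and the eigenvector itself.
\<close>

lemma exists_negative_eigenvector:
  fixes f :: "'a::euclidean_space \<Rightarrow> 'a"
  assumes lin: "linear f"
    and sym: "\<And>x y. f x \<bullet> y = x \<bullet> f y"
    and e: "e \<bullet> f e = 0" "f e \<noteq> 0"
  shows "\<exists>x l. l < 0 \<and> f x = l *\<^sub>R x \<and> x \<bullet> e \<noteq> 0"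
proof -
  define S where "S = \<Inter>{T. subspace T \<and> f ` T \<subseteq> T \<and> e \<in> T}"
  have sS: "subspace S" unfolding S_def by (rule subspace_Inter) auto
  have fS: "f ` S \<subseteq> S" unfolding S_def by blast
  have eS: "e \<in> S" unfolding S_def by blast
  have "\<exists>y\<in>S. y \<bullet> f y < 0"
    using psd_zero_imp_kernel[OF lin sym sS fS _ eS] e by (meson not_less)
  then obtain y where y: "y \<in> S" "y \<bullet> f y < 0" by blast
  have y0: "y \<noteq> 0" using y by auto
  define K where "K = S \<inter> sphere 0 1"
  have yK: "y /\<^sub>R norm y \<in> K"
    using y y0 sS by (simp add: K_def subspace_scale)
  have "compact K" unfolding K_def
    using closed_subspace[OF sS] by (metis compact_Int_closed compact_sphere inf_commute)
  moreover have "continuous_on K (\<lambda>x. x \<bullet> f x)"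
    by (intro continuous_intros linear_continuous_on linear_linear[THEN iffD1] lin)
      (use lin linear_conv_bounded_linear in auto)
  ultimately obtain x where x: "x \<in> K" "\<And>z. z \<in> K \<Longrightarrow> x \<bullet> f x \<le> z \<bullet> f z"
    using continuous_attains_inf[of K "\<lambda>x. x \<bullet> f x"] yK by blast
  define l where "l = x \<bullet> f x"
  have nx: "norm x = 1" "x \<in> S" using x by (auto simp: K_def)
  have "l \<le> (y /\<^sub>R norm y) \<bullet> f (y /\<^sub>R norm y)"
    using x(2)[OF yK] by (simp add: l_def)
  also have "\<dots> = (y \<bullet> f y) / (norm y)\<^sup>2"
    by (simp add: linear_scale[OF lin] power2_eq_square divide_inverse algebra_simps)
  also have "\<dots> < 0" using y y0 by (simp add: divide_neg_pos)
  finally have l: "l < 0" .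
  have min: "l * (z \<bullet> z) \<le> z \<bullet> f z" if z: "z \<in> S" for z
  proof (cases "z = 0")
    case True then show ?thesis by simp
  next
    case False
    then have "z /\<^sub>R norm z \<in> K" using z sS by (simp add: K_def subspace_scale)
    from x(2)[OF this] have "l \<le> (z \<bullet> f z) / (z \<bullet> z)"
      by (simp add: l_def linear_scale[OF lin] divide_inverse algebra_simps
          flip: power2_norm_eq_inner power2_eq_square)
        (simp add: power2_eq_square algebra_simps)
    then show ?thesis using False by (simp add: field_simps)
  qed
  define g where "g z = f z - l *\<^sub>R z" for z
  have "g x = 0"
  proof (rule psd_zero_imp_kernel[of g S])
    show "linear g" unfolding g_def
      by (intro linear_compose_sub lin linear_scale_self)
    show "g u \<bullet> w = u \<bullet> g w" for u w
      by (simp add: g_def inner_diff_left inner_diff_right sym)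
    show "g ` S \<subseteq> S" using fS sS by (auto simp: g_def intro!: subspace_diff subspace_scale)
    show "0 \<le> z \<bullet> g z" if "z \<in> S" for z
      using min[OF that] by (simp add: g_def inner_diff_right)
    show "x \<bullet> g x = 0"
      using nx by (simp add: g_def inner_diff_right l_def flip: power2_norm_eq_inner)
  qed (use sS nx in auto)
  then have ev: "f x = l *\<^sub>R x" by (simp add: g_def)
  have "x \<bullet> e \<noteq> 0"
  proof
    assume xe: "x \<bullet> e = 0"
    have "S \<subseteq> {z. x \<bullet> z = 0}" unfolding S_def
    proof (rule Inter_lower, safe)
      show "subspace {z. x \<bullet> z = 0}" by (rule subspace_hyperplane)
      show "x \<bullet> f z = 0" if "x \<bullet> z = 0" for z
        using that ev sym[of x z] by simp
    qed (rule xe)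
    then show False using nx by auto
  qed
  with l ev show ?thesis by blast
qed

section \<open>Rational eigenvalues of integer matrices\<close>

text \<open>
  If the eigenvalue is \<open>c / d\<close> in lowest terms, then \<open>d M - c I\<close> is singular, while modulo
  \<open>d\<close> its determinant is \<open>(- c)\<^sup>n\<close>. So \<open>d\<close> divides a power of \<open>c\<close>.
\<close>

lemma rational_eigenvalue_of_integer_matrix:
  fixes M :: "real^'n^'n"
  assumes int: "\<And>i j. M $ i $ j \<in> \<int>"
    and ev: "M *v x = r *\<^sub>R x" and x: "x \<noteq> 0" and r: "r \<in> \<rat>"
  shows "r \<in> \<int>"
proof -
  obtain N :: "'n \<Rightarrow> 'n \<Rightarrow> int" where N: "M $ i $ j = of_int (N i j)" for i j
    using int unfolding Ints_def image_iff by metis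
  obtain c d :: int where cd: "d > 0" "coprime c d" "r = of_int c / of_int d"
    using r by (metis Rats_cases')
  define D :: "int^'n^'n" where "D = (\<chi> i j. d * N i j - (if i = j then c else 0))"
  define D' :: "real^'n^'n" where "D' = (\<chi> i j. of_int (D $ i $ j))"
  have "D' *v x = of_int d *\<^sub>R (M *v x) - of_int c *\<^sub>R x"
  proof (rule vec_eq_iff[THEN iffD2], rule allI)
    fix i
    have "(D' *v x) $ i = (\<Sum>j\<in>UNIV. of_int d * (M $ i $ j * x $ j) - (if j = i then of_int c * x $ j else 0))"
      unfolding matrix_vector_mult_def D'_def D_def
      by (auto simp: N algebra_simps intro!: sum.cong)
    also have "\<dots> = of_int d * (M *v x) $ i - of_int c * x $ i"
      by (simp add: sum_subtractf matrix_vector_mult_def sum_distrib_left sum.delta)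
    finally show "(D' *v x) $ i = (of_int d *\<^sub>R (M *v x) - of_int c *\<^sub>R x) $ i" by simp
  qed
  also have "\<dots> = 0" using cd by (simp add: ev)
  finally have "D' *v x = 0" .
  then have "det D' = 0"
    using x by (metis invertible_det_nz inj_matrix_vector_mult injD matrix_vector_mult_0_right)
  moreover have "det D' = of_int (det D)"
    by (simp add: det_def D'_def)
  ultimately have "det D = 0" by simp
  moreover have "[det D = det (mat (- c) :: int^'n^'n)] (mod d)"
    unfolding det_def
    by (intro cong_sum cong_mult cong_refl cong_prod)
      (auto simp: D_def mat_def cong_iff_dvd_diff)
  moreover have "det (mat (- c) :: int^'n^'n) = (- c) ^ CARD('n)"
    by (subst det_diagonal) (auto simp: mat_def)
  ultimately have "d dvd (- c) ^ CARD('n)"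
    by (metis cong_0_iff cong_sym)
  then have "is_unit d"
    using cd by (metis coprime_power_left_iff coprime_minus_left_iff coprime_absorb_right coprime_commute zero_less_card_finite)
  then have "d = 1" using cd by auto
  then show ?thesis using cd by simp
qed

section \<open>The transition matrix\<close>

lemma matrix_power_0: "matrix_power A 0 = mat 1"
  by (simp add: matrix_power_def)

lemma matrix_power_Suc: "matrix_power A (Suc k) = A ** matrix_power A k"
  by (simp add: matrix_power_def)

lemma matrix_power_add: "matrix_power A (j + k) = matrix_power A j ** matrix_power A k"
  by (induction j) (simp_all add: matrix_power_0 matrix_power_Suc matrix_mul_assoc)

lemma transpose_matrix_power:
  assumes "transpose A = A"
  shows "transpose (matrix_power A k) = matrix_power A k"
proof (induction k)
  case 0
  show ?case by (simp add: matrix_power_0 transpose_mat)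
next
  case (Suc k)
  have "transpose (matrix_power A (Suc k)) = matrix_power A k ** matrix_power A 1"
    by (simp add: matrix_power_Suc matrix_power_0 matrix_transpose_mul Suc.IH assms)
  also have "\<dots> = matrix_power A (1 + k)"
    by (metis matrix_power_add add.commute)
  finally show ?case by simp
qed

lemma matrix_power_scale:
  "matrix_power (\<chi> u v. c * A $ u $ v) k $ i $ j = c ^ k * matrix_power A k $ i $ j"
proof (induction k arbitrary: i j)
  case (Suc k)
  then show ?case
    by (simp add: matrix_power_Suc matrix_matrix_mult_def sum_distrib_left mult_ac)
qed (simp add: matrix_power_0)

lemma cnj_matrix_power_adjacency:
  "cnj (matrix_power (adjacency_matrix X) k $ i $ j) = matrix_power (adjacency_matrix X) k $ i $ j"
proof (induction k arbitrary: i j)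
  case (Suc k)
  then show ?case
    by (auto simp: matrix_power_Suc matrix_matrix_mult_def adjacency_matrix_def intro!: sum.cong)
qed (simp add: matrix_power_0 mat_def)

lemma matrix_power_adjacency_sym:
  assumes "simple_graph X"
  shows "matrix_power (adjacency_matrix X) k $ j $ i = matrix_power (adjacency_matrix X) k $ i $ j"
proof -
  have "transpose (adjacency_matrix X) = adjacency_matrix X"
    using assms by (auto simp: transpose_def adjacency_matrix_def simple_graph_def vec_eq_iff symp_def)
  from transpose_matrix_power[OF this, of k]
  have "transpose (matrix_power (adjacency_matrix X) k) $ i $ j = matrix_power (adjacency_matrix X) k $ i $ j"
    by (simp only:)
  then show ?thesis by (simp add: transpose_def)
qed

lemma transition_matrix_entry_sums:
  "(\<lambda>k. (- (\<i> * complex_of_real t)) ^ k /\<^sub>R fact k * matrix_power (adjacency_matrix X) k $ u $ v)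
     sums (transition_matrix X t $ u $ v)"
proof -
  have "(\<lambda>k. (matrix_power (\<chi> u v. - (\<i> * complex_of_real t) * adjacency_matrix X $ u $ v) k
      /\<^sub>R fact k) $ u $ v) sums (transition_matrix X t $ u $ v)"
    unfolding transition_matrix_def
    by (intro bounded_linear.sums[OF bounded_linear_vec_nth] matrix_exp_sums)
  then show ?thesis by (simp only: matrix_power_scale vector_scaleR_component mult_scaleR_left)
qed

lemma summable_norm_transition_series:
  "summable (\<lambda>k. norm (c ^ k /\<^sub>R fact k * matrix_power (adjacency_matrix X) k $ u $ v))"
  for c :: complex and X :: "'v::finite \<Rightarrow> 'v \<Rightarrow> bool"
proof (rule summable_comparison_test)
  have "norm (matrix_power (adjacency_matrix X) k $ u $ v) \<le> (real CARD('v) * 1) ^ k" for k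
    by (rule norm_matrix_power_entry_le) (simp add: adjacency_matrix_def)
  then have "norm c ^ k * norm (matrix_power (adjacency_matrix X) k $ u $ v)
      \<le> (norm c * real CARD('v)) ^ k" for k
    by (auto simp: power_mult_distrib intro!: mult_left_mono)
  then show "\<exists>N. \<forall>k\<ge>N. norm (norm (c ^ k /\<^sub>R fact k * matrix_power (adjacency_matrix X) k $ u $ v))
      \<le> (norm c * real CARD('v)) ^ k /\<^sub>R fact k"
    by (auto simp: norm_mult norm_power field_simps intro!: divide_right_mono)
qed (rule summable_exp_generic)

lemma transition_matrix_sym:
  assumes "simple_graph X"
  shows "transition_matrix X t $ v $ u = transition_matrix X t $ u $ v"
  using transition_matrix_entry_sums[of t X v u] transition_matrix_entry_sums[of t X u v]
  by (simp only: matrix_power_adjacency_sym[OF assms, of _ v u]) (rule sums_unique2)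

lemma transition_matrix_0: "transition_matrix X 0 $ u $ v = (if u = v then 1 else 0)"
proof -
  have "(\<lambda>k. (- (\<i> * complex_of_real 0)) ^ k /\<^sub>R fact k * matrix_power (adjacency_matrix X) k $ u $ v)
    = (\<lambda>k. if k = 0 then (if u = v then 1 else 0) else 0)"
    by (auto simp: fun_eq_iff matrix_power_0 mat_def power_0_left)
  then show ?thesis
    using transition_matrix_entry_sums[of 0 X u v]
      sums_single[of 0 "\<lambda>_. if u = v then 1 else 0 :: complex"]
    by (simp only:) (rule sums_unique2)
qed

text \<open>
  The sum is a diagonal entry of the product of the conjugate transpose of \<open>U(t)\<close> with
  \<open>U(t)\<close>. By the Cauchy product of the two series it is the entry of
  \<open>exp ((cnj c + c) A)\<close> with \<open>c = - \<i> t\<close>, and \<open>cnj c + c = 0\<close>.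
\<close>

lemma transition_matrix_column_norm:
  assumes X: "simple_graph X"
  shows "(\<Sum>w\<in>UNIV. (cmod (transition_matrix X t $ w $ u))\<^sup>2) = 1"
proof -
  let ?P = "matrix_power (adjacency_matrix X)"
  let ?U = "transition_matrix X t"
  define c where "c = - (\<i> * complex_of_real t)"
  define S where "S z k = z ^ k /\<^sub>R fact k" for z :: complex and k :: nat
  have U: "(\<lambda>k. S c k * ?P k $ w $ u) sums (?U $ w $ u)" for w
    using transition_matrix_entry_sums[of t X w u] by (simp only: S_def c_def)
  then have "(\<lambda>k. cnj (S c k * ?P k $ w $ u)) sums cnj (?U $ w $ u)" for w
    by (simp only: sums_cnj)
  then have V: "(\<lambda>k. S (cnj c) k * ?P k $ w $ u) sums cnj (?U $ w $ u)" for w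
    by (simp add: S_def cnj_matrix_power_adjacency)
  have "(\<lambda>k. \<Sum>w\<in>UNIV. \<Sum>i\<le>k. (S (cnj c) i * ?P i $ w $ u) * (S c (k - i) * ?P (k - i) $ w $ u))
      sums (\<Sum>w\<in>UNIV. cnj (?U $ w $ u) * ?U $ w $ u)"
  proof (intro sums_sum)
    fix w
    have "summable (\<lambda>k. norm (S z k * ?P k $ w $ u))" for z
      unfolding S_def by (rule summable_norm_transition_series)
    from Cauchy_product_sums[OF this[of "cnj c"] this[of c]]
    show "(\<lambda>k. \<Sum>i\<le>k. (S (cnj c) i * ?P i $ w $ u) * (S c (k - i) * ?P (k - i) $ w $ u))
        sums (cnj (?U $ w $ u) * ?U $ w $ u)"
      by (simp only: sums_unique[OF U[of w], symmetric] sums_unique[OF V[of w], symmetric])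
  qed
  moreover have "(\<Sum>w\<in>UNIV. \<Sum>i\<le>k. (S (cnj c) i * ?P i $ w $ u) * (S c (k - i) * ?P (k - i) $ w $ u))
      = (if k = 0 then 1 else 0)" for k
  proof -
    have "(\<Sum>w\<in>UNIV. \<Sum>i\<le>k. (S (cnj c) i * ?P i $ w $ u) * (S c (k - i) * ?P (k - i) $ w $ u))
      = (\<Sum>i\<le>k. S (cnj c) i * S c (k - i) * (\<Sum>w\<in>UNIV. ?P i $ u $ w * ?P (k - i) $ w $ u))"
      by (subst sum.swap) (simp add: sum_distrib_left matrix_power_adjacency_sym[OF X, of _ _ u] mult_ac)
    also have "\<dots> = (\<Sum>i\<le>k. S (cnj c) i * S c (k - i) * ?P k $ u $ u)"
    proof (rule sum.cong[OF refl])
      fix i assume "i \<in> {..k}"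
      then have "?P k = ?P i ** ?P (k - i)"
        by (simp flip: matrix_power_add)
      then show "S (cnj c) i * S c (k - i) * (\<Sum>w\<in>UNIV. ?P i $ u $ w * ?P (k - i) $ w $ u)
          = S (cnj c) i * S c (k - i) * ?P k $ u $ u"
        by (simp add: matrix_matrix_mult_def)
    qed
    also have "\<dots> = S (cnj c + c) k * ?P k $ u $ u"
      unfolding S_def by (subst exp_series_add_commuting) (simp_all add: sum_distrib_right)
    also have "\<dots> = (if k = 0 then 1 else 0)"
      by (simp add: S_def c_def matrix_power_0 mat_def)
    finally show ?thesis .
  qed
  ultimately have "(\<lambda>k. if k = 0 then 1 else 0) sums (\<Sum>w\<in>UNIV. cnj (?U $ w $ u) * ?U $ w $ u)"
    by simp
  with sums_single[of 0 "\<lambda>_. 1::complex"]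
  have "(\<Sum>w\<in>UNIV. cnj (?U $ w $ u) * ?U $ w $ u) = 1"
    using sums_unique2 by fastforce
  then have "complex_of_real (\<Sum>w\<in>UNIV. (cmod (?U $ w $ u))\<^sup>2) = 1"
    by (simp add: complex_norm_square mult.commute del: of_real_power)
  then show ?thesis by (simp only: of_real_eq_1_iff)
qed

text \<open>
  The adjacency matrix over the reals, so that its eigenvectors live in a Euclidean space.
\<close>

definition real_adjacency :: "('v::finite \<Rightarrow> 'v \<Rightarrow> bool) \<Rightarrow> real^'v^'v" where
  "real_adjacency X = (\<chi> u v. if X u v then 1 else 0)"

text \<open>
  A real eigenvector of the symmetric adjacency matrix is a left eigenvector of \<open>U(t)\<close>.
\<close>

lemma eigenvector_transition_matrix:
  assumes X: "simple_graph X" and ev: "real_adjacency X *v x = \<mu> *\<^sub>R x"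
  shows "(\<Sum>w\<in>UNIV. complex_of_real (x $ w) * transition_matrix X t $ w $ u)
    = exp (- (\<i> * complex_of_real (t * \<mu>))) * complex_of_real (x $ u)"
proof -
  let ?P = "matrix_power (adjacency_matrix X)"
  define c where "c = - (\<i> * complex_of_real t)"
  have A: "(\<Sum>w\<in>UNIV. complex_of_real (x $ w) * adjacency_matrix X $ w $ v)
      = of_real \<mu> * complex_of_real (x $ v)" for v
  proof -
    have "(\<Sum>w\<in>UNIV. complex_of_real (x $ w) * adjacency_matrix X $ w $ v)
      = complex_of_real ((real_adjacency X *v x) $ v)"
      using X by (auto simp: matrix_vector_mult_def real_adjacency_def adjacency_matrix_def
          simple_graph_def symp_def intro!: sum.cong)
    then show ?thesis by (simp add: ev)
  qed
  have P: "(\<Sum>w\<in>UNIV. complex_of_real (x $ w) * ?P k $ w $ v)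
      = of_real \<mu> ^ k * complex_of_real (x $ v)" for k v
  proof (induction k arbitrary: v)
    case 0
    show ?case by (simp add: matrix_power_0 mat_def if_distrib sum.delta cong: if_cong)
  next
    case (Suc k)
    have "(\<Sum>w\<in>UNIV. complex_of_real (x $ w) * ?P (Suc k) $ w $ v)
      = (\<Sum>w\<in>UNIV. \<Sum>y\<in>UNIV. complex_of_real (x $ w) * adjacency_matrix X $ w $ y * ?P k $ y $ v)"
      by (simp add: matrix_power_Suc matrix_matrix_mult_def sum_distrib_left mult_ac)
    also have "\<dots> = (\<Sum>y\<in>UNIV. (\<Sum>w\<in>UNIV. complex_of_real (x $ w) * adjacency_matrix X $ w $ y) * ?P k $ y $ v)"
      by (subst sum.swap) (simp add: sum_distrib_right)
    also have "\<dots> = of_real \<mu> * (\<Sum>y\<in>UNIV. complex_of_real (x $ y) * ?P k $ y $ v)"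
      by (simp only: A sum_distrib_left mult.assoc)
    finally show ?case by (simp add: Suc.IH)
  qed
  have "(\<lambda>k. \<Sum>w\<in>UNIV. complex_of_real (x $ w) * (c ^ k /\<^sub>R fact k * ?P k $ w $ u))
     sums (\<Sum>w\<in>UNIV. complex_of_real (x $ w) * transition_matrix X t $ w $ u)"
    unfolding c_def by (intro sums_sum sums_mult transition_matrix_entry_sums)
  moreover have "(\<Sum>w\<in>UNIV. complex_of_real (x $ w) * (c ^ k /\<^sub>R fact k * ?P k $ w $ u))
     = (c * of_real \<mu>) ^ k /\<^sub>R fact k * complex_of_real (x $ u)" for k
  proof -
    have "(\<Sum>w\<in>UNIV. complex_of_real (x $ w) * (c ^ k /\<^sub>R fact k * ?P k $ w $ u))
      = c ^ k /\<^sub>R fact k * (\<Sum>w\<in>UNIV. complex_of_real (x $ w) * ?P k $ w $ u)"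
      unfolding sum_distrib_left by (simp add: mult_ac)
    then show ?thesis by (simp add: P power_mult_distrib)
  qed
  moreover have "(\<lambda>k. (c * of_real \<mu>) ^ k /\<^sub>R fact k * complex_of_real (x $ u))
     sums (exp (c * of_real \<mu>) * complex_of_real (x $ u))"
    by (intro sums_mult2 exp_converges)
  ultimately have "(\<Sum>w\<in>UNIV. complex_of_real (x $ w) * transition_matrix X t $ w $ u)
      = exp (c * of_real \<mu>) * complex_of_real (x $ u)"
    using sums_unique2 by simp
  then show ?thesis by (simp add: c_def mult.assoc)
qed

text \<open>
  A unimodular entry is the only nonzero entry of its column, because columns have norm 1. By
  symmetry of the transition matrix this holds for column \<open>u\<close> and for column \<open>v\<close>, and going
  from \<open>u\<close> to \<open>v\<close> and back yields a phase that does not depend on the eigenvector. The case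
  \<open>u = v\<close> is included.
\<close>

lemma phase_of_unimodular_entry:
  assumes X: "simple_graph X" and uv: "cmod (transition_matrix X t $ v $ u) = 1"
    and ev: "real_adjacency X *v x = \<mu> *\<^sub>R x" and xu: "x $ u \<noteq> 0"
  shows "exp (- (\<i> * complex_of_real (2 * t * \<mu>))) = (transition_matrix X t $ v $ u)\<^sup>2"
proof -
  define g where "g = transition_matrix X t $ v $ u"
  have col: "transition_matrix X t $ w $ b = (if w = a then transition_matrix X t $ a $ b else 0)"
    if "cmod (transition_matrix X t $ a $ b) = 1" for a b w
  proof -
    have "(\<Sum>w\<in>UNIV - {a}. (cmod (transition_matrix X t $ w $ b))\<^sup>2) = 0"
      using transition_matrix_column_norm[OF X, of t b] that
      by (simp add: sum.remove[of UNIV a])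
    then have "\<forall>w\<in>UNIV - {a}. (cmod (transition_matrix X t $ w $ b))\<^sup>2 = 0"
      by (subst (asm) sum_nonneg_eq_0_iff) auto
    then show ?thesis by auto
  qed
  let ?e = "exp (- (\<i> * complex_of_real (t * \<mu>)))"
  have vu: "cmod (transition_matrix X t $ u $ v) = 1" "transition_matrix X t $ u $ v = g"
    using uv transition_matrix_sym[OF X, of t u v] by (simp_all add: g_def)
  have 1: "complex_of_real (x $ v) * g = ?e * complex_of_real (x $ u)"
    using eigenvector_transition_matrix[OF X ev, of t u]
    by (subst (asm) col[OF uv]) (simp add: g_def if_distrib sum.delta cong: if_cong)
  have 2: "complex_of_real (x $ u) * g = ?e * complex_of_real (x $ v)"
    using eigenvector_transition_matrix[OF X ev, of t v]
    by (subst (asm) col[OF vu(1)]) (simp add: vu(2) if_distrib sum.delta cong: if_cong)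
  have "complex_of_real (x $ u) * g\<^sup>2 = ?e * (complex_of_real (x $ v) * g)"
    using 2 by (simp add: power2_eq_square mult_ac)
  also have "\<dots> = complex_of_real (x $ u) * ?e\<^sup>2"
    by (simp only: 1) (simp add: power2_eq_square)
  finally have "g\<^sup>2 = ?e\<^sup>2" using xu by simp
  also have "\<dots> = exp (- (\<i> * complex_of_real (2 * t * \<mu>)))"
    by (simp add: exp_double[symmetric] mult_ac)
  finally show ?thesis by (simp add: g_def)
qed

lemma eigenvalue_difference_of_unimodular_entry:
  assumes X: "simple_graph X" and uv: "cmod (transition_matrix X t $ v $ u) = 1" and t: "t \<noteq> 0"
    and x: "real_adjacency X *v x = \<mu> *\<^sub>R x" "x $ u \<noteq> 0"
    and y: "real_adjacency X *v y = \<nu> *\<^sub>R y" "y $ u \<noteq> 0"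
  shows "\<exists>n::int. \<mu> - \<nu> = of_int n * (pi / t)"
proof -
  have "exp (- (\<i> * complex_of_real (2 * t * \<nu>))) = exp (- (\<i> * complex_of_real (2 * t * \<mu>)))"
    by (simp only: phase_of_unimodular_entry[OF X uv x] phase_of_unimodular_entry[OF X uv y])
  then obtain n :: int where "- (\<i> * complex_of_real (2 * t * \<nu>))
      = - (\<i> * complex_of_real (2 * t * \<mu>)) + (of_int (2 * n) * pi) * \<i>"
    unfolding exp_eq by auto
  then have "Im (- (\<i> * complex_of_real (2 * t * \<nu>)))
      = Im (- (\<i> * complex_of_real (2 * t * \<mu>)) + (of_int (2 * n) * pi) * \<i>)"
    by simp
  then have "t * (\<mu> - \<nu>) = of_int n * pi" by (simp add: algebra_simps)
  then show ?thesis using t by (auto simp: field_simps)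
qed

section \<open>Eigenvectors of the corona with a complete graph\<close>

text \<open>
  The vector on the corona that is \<open>x\<close> on \<open>G\<close> and \<open>x v / p\<close> on every vertex of the copy of
  \<open>K\<^sub>m\<close> at \<open>v\<close>. It is meant for \<open>p \<noteq> 0\<close>.
\<close>

definition corona_lift :: "real \<Rightarrow> real^'v \<Rightarrow> real^('v::finite \<times> 'm::finite option)" where
  "corona_lift p x = (\<chi> q. case snd q of None \<Rightarrow> x $ fst q | Some _ \<Rightarrow> x $ fst q / p)"

lemma sum_option_UNIV: "(\<Sum>y\<in>UNIV. f y) = f None + (\<Sum>y\<in>UNIV. f (Some y))"
  for f :: "'m::finite option \<Rightarrow> 'a::comm_monoid_add"
  by (simp add: UNIV_option_conv sum.reindex)

lemma corona_lift_eigenvector: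
  fixes G :: "'v::finite \<Rightarrow> 'v \<Rightarrow> bool" and x :: "real^'v"
  assumes ev: "real_adjacency G *v x = l *\<^sub>R x"
    and p: "p\<^sup>2 = (l - real CARD('m) + 1) * p + real CARD('m)"
  shows "real_adjacency (corona G (complete_graph :: 'm::finite \<Rightarrow> 'm \<Rightarrow> bool)) *v corona_lift p x
    = (p + real CARD('m) - 1) *\<^sub>R corona_lift p x"
    (is "?A *v ?x = ?mu *\<^sub>R ?x")
proof (rule vec_eq_iff[THEN iffD2], rule allI)
  have p0: "p \<noteq> 0" using p by auto
  fix q :: "'v \<times> 'm option"
  obtain v w where q: "q = (v, w)" by fastforce
  have row: "(?A *v ?x) $ q = (\<Sum>v'\<in>UNIV. (if corona G complete_graph (v, w) (v', None) then x $ v' else 0)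
      + (\<Sum>y\<in>(UNIV::'m set). if corona G complete_graph (v, w) (v', Some y) then x $ v' / p else 0))"
    unfolding q matrix_vector_mult_def UNIV_Times_UNIV[symmetric] sum.cartesian_product'
    by (auto simp: sum_option_UNIV real_adjacency_def corona_lift_def
        intro!: sum.cong arg_cong2[where f = "(+)"])
  have Gx: "(\<Sum>v'\<in>UNIV. if G v v' then x $ v' else 0) = l * x $ v"
  proof -
    have "(\<Sum>v'\<in>UNIV. if G v v' then x $ v' else 0) = (real_adjacency G *v x) $ v"
      by (auto simp: matrix_vector_mult_def real_adjacency_def intro!: sum.cong)
    then show ?thesis by (simp add: ev)
  qed
  show "(?A *v ?x) $ q = (?mu *\<^sub>R ?x) $ q"
  proof (cases w)
    case None
    have "(?A *v ?x) $ q = (\<Sum>v'\<in>UNIV. (if G v v' then x $ v' else 0)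
        + (if v' = v then real CARD('m) * (x $ v' / p) else 0))"
      unfolding row None by (intro sum.cong) (auto simp: corona_def)
    also have "\<dots> = l * x $ v + real CARD('m) * (x $ v / p)"
      by (simp add: sum.distrib Gx sum.delta)
    also have "\<dots> = ?mu * x $ v"
      using p p0 by (simp add: field_simps power2_eq_square) algebra
    finally show ?thesis by (simp add: q None corona_lift_def)
  next
    case (Some y)
    have card: "(\<Sum>z\<in>(UNIV::'m set). if y \<noteq> z then c else 0) = (real CARD('m) - 1) * c" for c :: real
    proof -
      have "(\<Sum>z\<in>(UNIV::'m set). if y \<noteq> z then c else 0) = (\<Sum>z\<in>UNIV - {y}. c)"
        by (rule sum.mono_neutral_cong_right) auto
      also have "\<dots> = (real CARD('m) - 1) * c"
        by (simp add: card_Diff_singleton of_nat_diff Suc_le_eq)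
      finally show ?thesis .
    qed
    have "(?A *v ?x) $ q = (\<Sum>v'\<in>UNIV. if v' = v then x $ v' + (real CARD('m) - 1) * (x $ v' / p) else 0)"
      unfolding row Some card[symmetric] by (intro sum.cong) (auto simp: corona_def complete_graph_def)
    also have "\<dots> = ?mu * (x $ v / p)"
      using p0 by (simp add: sum.delta field_simps)
    finally show ?thesis by (simp add: q Some corona_lift_def)
  qed
qed

section \<open>Arithmetic of the eigenvalues\<close>

text \<open>
  Here \<open>s\<close> and \<open>t\<close> are square roots of the discriminants of \<open>p\<^sup>2 = a p + m\<close> and
  \<open>p\<^sup>2 = b p + m\<close>. Dividing \<open>a\<^sup>2 - b\<^sup>2 = s\<^sup>2 - t\<^sup>2\<close> by \<open>a - b\<close> shows that \<open>a + b\<close>, hence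
  \<open>a\<close>, is a rational multiple of \<open>d\<close>; then \<open>4 m = s\<^sup>2 - a\<^sup>2\<close> makes \<open>d\<^sup>2\<close> rational.
\<close>

lemma rational_square_of_commensurable_roots:
  fixes a b s t d m :: real and j k l :: int
  assumes s: "s = of_int k * d" "s\<^sup>2 = a\<^sup>2 + 4 * m"
    and t: "t = of_int l * d" "t\<^sup>2 = b\<^sup>2 + 4 * m"
    and ab: "a - b = of_int j * d" "a \<noteq> b"
    and m: "m \<in> \<rat>" "m > 0"
  shows "((a + s) / 2)\<^sup>2 \<in> \<rat>"
proof -
  have j: "j \<noteq> 0" "d \<noteq> 0" using ab by auto
  define r :: real where "r = (of_int k ^ 2 - of_int l ^ 2) / of_int j"
  have "(a + b) * (of_int j * d) = a\<^sup>2 - b\<^sup>2"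
    unfolding ab(1)[symmetric] by (simp add: power2_eq_square algebra_simps)
  also have "\<dots> = s\<^sup>2 - t\<^sup>2" using s(2) t(2) by simp
  also have "\<dots> = r * d * (of_int j * d)"
    using j by (simp add: s(1) t(1) r_def power_mult_distrib power2_eq_square field_simps)
  finally have "a + b = r * d" using j by simp
  define q where "q = (of_int j + r) / 2"
  have a: "a = q * d" using ab(1) \<open>a + b = r * d\<close> by (simp add: q_def field_simps)
  have q: "q \<in> \<rat>" by (auto simp: q_def r_def)
  have m4: "4 * m = ((of_int k)\<^sup>2 - q\<^sup>2) * d\<^sup>2"
    using s by (simp add: a power_mult_distrib algebra_simps)
  then have nz: "(of_int k)\<^sup>2 - q\<^sup>2 \<noteq> 0" using m(2) by auto
  have "((a + s) / 2)\<^sup>2 = ((q + of_int k) / 2)\<^sup>2 * d\<^sup>2"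
    by (simp add: a s(1) power2_eq_square algebra_simps)
  also have "d\<^sup>2 = 4 * m / ((of_int k)\<^sup>2 - q\<^sup>2)"
    using m4 nz by (simp add: field_simps)
  also have "((q + of_int k) / 2)\<^sup>2 * \<dots> \<in> \<rat>"
    using q m(1) by simp
  finally show ?thesis .
qed

text \<open>
  Shifting by an integer keeps the matrix integral, so \<open>p\<^sup>2\<close> is an eigenvalue of the integer
  matrix \<open>(A - n I)\<^sup>2\<close>.
\<close>

lemma square_of_shifted_eigenvalue_integer:
  fixes X :: "'c::finite \<Rightarrow> 'c \<Rightarrow> bool"
  assumes ev: "real_adjacency X *v y = (p + of_int n) *\<^sub>R y" and y: "y \<noteq> 0" and p: "p\<^sup>2 \<in> \<rat>"
  shows "p\<^sup>2 \<in> \<int>"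
proof -
  define B :: "real^'c^'c" where "B = real_adjacency X - mat (of_int n)"
  have B: "B *v y = p *\<^sub>R y"
  proof -
    have "mat (of_int n) *v y = of_int n *\<^sub>R y"
      by (simp add: vec_eq_iff matrix_vector_mult_def mat_def if_distrib if_distribR sum.delta' cong: if_cong)
    then show ?thesis
      by (simp add: B_def matrix_vector_mult_diff_rdistrib ev algebra_simps)
  qed
  have "(B ** B) *v y = p\<^sup>2 *\<^sub>R y"
    by (simp add: matrix_vector_mul_assoc[symmetric] B matrix_vector_mult_scaleR power2_eq_square)
  moreover have "(B ** B) $ i $ j \<in> \<int>" for i j
    by (auto simp: matrix_matrix_mult_def B_def real_adjacency_def mat_def)
  ultimately show ?thesis
    using rational_eigenvalue_of_integer_matrix y p by blast
qed

section \<open>Eigenvectors of both signs at a vertex with a neighbour\<close>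

text \<open>
  The basis vector \<open>e\<close> at \<open>v\<close> satisfies \<open>e \<bullet> A e = 0\<close>, as there are no loops, and
  \<open>A e \<noteq> 0\<close>, as \<open>v\<close> has a neighbour. So the lemma on negative eigenvectors applies to
  \<open>A\<close> and to \<open>- A\<close>.
\<close>

lemma eigenvectors_of_both_signs:
  fixes G :: "'v::finite \<Rightarrow> 'v \<Rightarrow> bool"
  assumes G: "simple_graph G" and c: "G c v"
  shows "\<exists>x l. l < 0 \<and> real_adjacency G *v x = l *\<^sub>R x \<and> x $ v \<noteq> 0"
    and "\<exists>x l. l > 0 \<and> real_adjacency G *v x = l *\<^sub>R x \<and> x $ v \<noteq> 0"
proof -
  let ?A = "real_adjacency G"
  let ?e = "axis v 1 :: real^'v"
  have sym: "(?A *v x) \<bullet> y = x \<bullet> (?A *v y)" for x y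
  proof -
    have "transpose ?A = ?A"
      using G by (auto simp: transpose_def real_adjacency_def simple_graph_def symp_def vec_eq_iff)
    then show ?thesis by (metis dot_lmul_matrix vector_transpose_matrix)
  qed
  have e: "?e \<bullet> (?A *v ?e) = 0"
    using G by (simp add: matrix_vector_mult_basis inner_axis' column_def real_adjacency_def
        simple_graph_def irreflp_def)
  have "(?A *v ?e) $ c = 1"
    using c by (simp add: matrix_vector_mult_basis column_def real_adjacency_def)
  then have nz: "?A *v ?e \<noteq> 0" by auto
  show "\<exists>x l. l < 0 \<and> ?A *v x = l *\<^sub>R x \<and> x $ v \<noteq> 0"
    using exists_negative_eigenvector[of "(*v) ?A" ?e] sym e nz
    by (simp add: inner_axis)
  \<comment> \<open>A negative eigenvalue of \<open>- A\<close> is a positive one of \<open>A\<close>.\<close>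
  have "\<exists>x l. l < 0 \<and> - (?A *v x) = l *\<^sub>R x \<and> x \<bullet> ?e \<noteq> 0"
    using sym e nz
    by (intro exists_negative_eigenvector) (auto intro: linear_compose_neg)
  then obtain x l where "l < 0" "- (?A *v x) = l *\<^sub>R x" "x $ v \<noteq> 0"
    by (auto simp: inner_axis)
  then have "- l > 0 \<and> ?A *v x = (- l) *\<^sub>R x \<and> x $ v \<noteq> 0"
    by (metis neg_0_less_iff_less minus_minus scaleR_minus_left)
  then show "\<exists>x l. l > 0 \<and> ?A *v x = l *\<^sub>R x \<and> x $ v \<noteq> 0" by blast
qed

lemma connected_graph_neighbour:
  fixes G :: "'v::finite \<Rightarrow> 'v \<Rightarrow> bool"
  assumes "connected_graph G" "CARD('v) \<ge> 2"
  obtains c where "G c v"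
proof -
  have "(UNIV :: 'v set) \<noteq> {v}"
    using assms(2) by (metis card.empty card.insert empty_iff finite.emptyI not_less_eq_eq numeral_2_eq_2 order_refl)
  then obtain w where "w \<noteq> v" by blast
  moreover have "G\<^sup>*\<^sup>* w v" using assms(1) by (simp add: connected_graph_def)
  ultimately show ?thesis by (metis rtranclp.cases that)
qed

section \<open>No unimodular entries in the transition matrix\<close>

lemma corona_complete_no_unimodular_entry:
  fixes G :: "'v::finite \<Rightarrow> 'v \<Rightarrow> bool"
  defines "X \<equiv> corona G (complete_graph :: 'm::finite \<Rightarrow> 'm \<Rightarrow> bool)"
  assumes G: "simple_graph G" "connected_graph G" "CARD('v) \<ge> 2" and t: "t \<noteq> 0"
  shows "cmod (transition_matrix X t $ v $ u) \<noteq> 1"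
proof
  assume uv: "cmod (transition_matrix X t $ v $ u) = 1"
  define m where "m = real CARD('m)"
  have m: "m > 0" "m \<in> \<rat>" by (auto simp: m_def)
  have X: "simple_graph X"
    unfolding X_def by (intro simple_graph_corona simple_graph_complete_graph G)
  obtain b w where u: "u = (b, w)" by fastforce
  obtain c where c: "G c b" using connected_graph_neighbour[OF G(2,3)] .
  obtain x l where x: "l < 0" "real_adjacency G *v x = l *\<^sub>R x" "x $ b \<noteq> 0"
    using eigenvectors_of_both_signs(1)[OF G(1) c] by blast
  obtain y k where y: "k > 0" "real_adjacency G *v y = k *\<^sub>R y" "y $ b \<noteq> 0"
    using eigenvectors_of_both_signs(2)[OF G(1) c] by blast
  \<comment> \<open>For \<open>e = 1\<close> and \<open>e = -1\<close>, the two roots \<open>p\<close> of \<open>p\<^sup>2 = a p + m\<close>.\<close>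
  define root where "root a e = (a + e * sqrt (a\<^sup>2 + 4 * m)) / 2" for a e :: real
  have root: "(root a e)\<^sup>2 = a * root a e + m" if "e\<^sup>2 = 1" for a e
  proof -
    have "(e * sqrt (a\<^sup>2 + 4 * m))\<^sup>2 = a\<^sup>2 + 4 * m"
      using that m by (simp add: power_mult_distrib)
    then show ?thesis
      by (simp add: root_def power2_sum power_divide field_simps power2_eq_square)
  qed
  have lift: "real_adjacency X *v corona_lift (root (l - m + 1) e) x
      = (root (l - m + 1) e + m - 1) *\<^sub>R corona_lift (root (l - m + 1) e) x"
      "corona_lift (root (l - m + 1) e) x $ u \<noteq> 0"
    if "e\<^sup>2 = 1" "real_adjacency G *v x = l *\<^sub>R x" "x $ b \<noteq> 0" for e l x
  proof -
    have "root (l - m + 1) e \<noteq> 0" using root[OF that(1), of "l - m + 1"] m(1) by auto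
    then show "corona_lift (root (l - m + 1) e) x $ u \<noteq> 0"
      using that(3) by (auto simp: u corona_lift_def split: option.split)
    show "real_adjacency X *v corona_lift (root (l - m + 1) e) x
      = (root (l - m + 1) e + m - 1) *\<^sub>R corona_lift (root (l - m + 1) e) x"
      unfolding X_def m_def
      by (rule corona_lift_eigenvector[OF that(2)]) (use root[OF that(1)] in \<open>simp add: m_def\<close>)
  qed
  define d where "d = pi / t"
  note diff = eigenvalue_difference_of_unimodular_entry[OF X uv t, folded d_def]
  define a where "a = l - m + 1"
  define a' where "a' = k - m + 1"
  note lx = lift[OF _ x(2,3), folded a_def] and ly = lift[OF _ y(2,3), folded a'_def]
  obtain n1 :: int where "root a 1 - root a (-1) = of_int n1 * d"
    using diff[OF lx[of 1] lx[of "-1"]] by auto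
  then have s: "sqrt (a\<^sup>2 + 4 * m) = of_int n1 * d" by (simp add: root_def field_simps)
  obtain n2 :: int where "root a' 1 - root a' (-1) = of_int n2 * d"
    using diff[OF ly[of 1] ly[of "-1"]] by auto
  then have s': "sqrt (a'\<^sup>2 + 4 * m) = of_int n2 * d" by (simp add: root_def field_simps)
  obtain n3 :: int where "root a 1 - root a' 1 = of_int n3 * d"
    using diff[OF lx[of 1] ly[of 1]] by auto
  then have j: "a - a' = of_int (2 * n3 - n1 + n2) * d"
    using s s' by (simp add: root_def field_simps)
  define p where "p = root a 1"
  have "p\<^sup>2 \<in> \<rat>"
    unfolding p_def root_def mult_1
    by (rule rational_square_of_commensurable_roots[OF s _ s' _ j _ m(2,1)])
      (use m x(1) y(1) in \<open>auto simp: a_def a'_def\<close>)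
  moreover have "corona_lift p x \<noteq> (0 :: real^('v \<times> 'm option))"
    using lx(2)[of 1] by (auto simp: p_def)
  ultimately have "p\<^sup>2 \<in> \<int>"
    using lx(1)[of 1] square_of_shifted_eigenvalue_integer[of X "corona_lift p x" p "int CARD('m) - 1"]
    by (simp add: p_def m_def add_diff_eq)
  then obtain N :: int where N: "p\<^sup>2 = of_int N" by (auto elim: Ints_cases)
  have "sqrt (a\<^sup>2) < sqrt (a\<^sup>2 + 4 * m)" using m by (intro real_sqrt_less_mono) simp
  then have p0: "p > 0" by (simp add: p_def root_def)
  then have "N > 0" using N by (metis of_int_0_less_iff zero_less_power)
  then have "1 \<le> p\<^sup>2" using N by simp
  then have p1: "1 \<le> p"
    by (intro power2_le_imp_le[of 1 p]) (use p0 in simp_all)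
  have "p * (p - a) = m" using root[of 1 a] by (simp add: p_def power2_eq_square algebra_simps)
  \<comment> \<open>\<open>l < 0\<close> means \<open>a < 1 - m\<close>, so \<open>p \<ge> 1\<close> forces \<open>p - a > m\<close>.\<close>
  moreover have "p * (p - a) > p * m"
    using p0 p1 x(1) by (intro mult_strict_left_mono) (auto simp: a_def)
  moreover have "p * m \<ge> m" using p1 m by simp
  ultimately show False by linarith
qed

theorem theorem4p7:
  fixes G :: "'v::finite \<Rightarrow> 'v \<Rightarrow> bool"
    and K\<^sub>m :: "'m::finite \<Rightarrow> 'm \<Rightarrow> bool"
  assumes "simple_graph G"
    and "connected_graph G"
    and "CARD('v) \<ge> 2"
    and "K\<^sub>m = complete_graph"
  shows "(\<forall>u. \<not> periodic_vertex (corona G K\<^sub>m) u) \<and>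
    (\<forall>u v \<tau>. u \<noteq> v \<longrightarrow> \<not> perfect_state_transfer_at (corona G K\<^sub>m) u v \<tau>)"
proof -
  have entry: "(U *v axis u 1) $ v = U $ v $ u" for U :: "complex^'c^'c" and u v
    by (simp add: matrix_vector_mult_def axis_def if_distrib sum.delta cong: if_cong)
  have key: "cmod (transition_matrix (corona G K\<^sub>m) \<tau> $ v $ u) \<noteq> 1" if "\<tau> \<noteq> 0" for \<tau> u v
    unfolding assms(4) by (rule corona_complete_no_unimodular_entry[OF assms(1-3) that])
  \<comment> \<open>Transfer at time 0 has to be excluded separately, from \<open>U(0) = I\<close>.\<close>
  have "\<not> perfect_state_transfer_at (corona G K\<^sub>m) u v \<tau>" if "u \<noteq> v" for u v \<tau>
    using that key[of \<tau> v u] transition_matrix_0[of "corona G K\<^sub>m" v u]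
    by (cases "\<tau> = 0") (auto simp: perfect_state_transfer_at_def entry)
  then show ?thesis
    using key by (auto simp: periodic_vertex_def entry)
qed

end
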